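(* Let $d \geq 3$, let $e_1,\ldots,e_d$ be the standard unit vectors of $\mathbb{R}^d$, and let $(b_n)_{n\ge 0}$ be the Sylvester sequence, $b_0 = 2$ and $b_n = 1 + b_0 b_1\cdots b_{n-1}$ for $n \geq 1$. Let $\mathcal{P} \subset \mathbb{R}^d$ be the $d$-dimensional simplex with vertices $v_0, v_1, \ldots, v_d$ given by $$v_0 = -3e_1 - 2\sum_{j=2}^{d} e_j,\qquad v_1 = e_1,\qquad v_i = e_1 + 2e_i \ \ (i=2,3),\qquad v_i = e_1 + 2b_{i-4}e_i \ \ (4 \le i \le d).$$ Then $\mathcal{P}$ is reflexive, $\mathcal{P}$ is unimodularly equivalent to its dual polytope $\mathcal{P}^\vee$, and $\mathrm{Vol}(\mathcal{P}) < b_d - 1$, where $\mathrm{Vol}$ denotes normalized volume.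
   Context: An integral convex polytope is a convex polytope whose vertices have integer coordinates. For a polytope $\mathcal{P}\subset\mathbb{R}^d$ containing the origin in its interior, its dual is $\mathcal{P}^\vee = \{y \in \mathbb{R}^d : \langle x,y\rangle \le 1 \text{ for all } x \in \mathcal{P}\}$. An integral convex polytope $\mathcal{P} \subset \mathbb{R}^d$ of dimension $d$ is reflexive if the origin is the unique integer point in the interior of $\mathcal{P}$ and $\mathcal{P}^\vee$ is also an integral polytope. Two integral convex polytopes $\mathcal{P}, \mathcal{Q} \subset \mathbb{R}^d$ of dimension $d$ are unimodularly equivalent if there are a matrix $U \in \mathbb{Z}^{d\times d}$ with $\det U = \pm 1$ and a vector $w \in \mathbb{Z}^d$ such that $\mathcal{Q} = f_U(\mathcal{P}) + w$, where $f_U(v) = vU$ (row vectors). The normalized volume $\mathrm{Vol}(\mathcal{P})$ is $d!$ times the Euclidean volume of $\mathcal{P}$. *)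

theory Defs
  imports "HOL-Analysis.Analysis"
begin

definition integer_point :: "real ^ 'n \<Rightarrow> bool" where
  "integer_point x \<longleftrightarrow> (\<forall>i. x $ i \<in> \<int>)"

definition integral_polytope :: "(real ^ 'n::finite) set \<Rightarrow> bool" where
  "integral_polytope P \<longleftrightarrow>
     polytope P \<and> (\<forall>v. v extreme_point_of P \<longrightarrow> integer_point v)"

definition dual_polytope :: "(real ^ 'n::finite) set \<Rightarrow> (real ^ 'n) set" where
  "dual_polytope P = {y. \<forall>x\<in>P. x \<bullet> y \<le> 1}"

definition reflexive :: "(real ^ 'n::finite) set \<Rightarrow> bool" where
  "reflexive P \<longleftrightarrow>
     integral_polytope P \<and> aff_dim P = int CARD('n) \<and>
     {x \<in> interior P. integer_point x} = {0} \<and>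
     integral_polytope (dual_polytope P)"

(* Row-vector convention: x v* U is the product of the row vector x with U. *)
definition unimodularly_equivalent ::
    "(real ^ 'n::finite) set \<Rightarrow> (real ^ 'n) set \<Rightarrow> bool" where
  "unimodularly_equivalent P Q \<longleftrightarrow>
     integral_polytope P \<and> aff_dim P = int CARD('n) \<and>
     integral_polytope Q \<and> aff_dim Q = int CARD('n) \<and>
     (\<exists>(U :: real ^ 'n ^ 'n) w.
        (\<forall>i j. U $ i $ j \<in> \<int>) \<and> (det U = 1 \<or> det U = - 1) \<and> integer_point w \<and>
        Q = (\<lambda>x. x v* U + w) ` P)"

definition normalized_volume :: "(real ^ 'n::finite) set \<Rightarrow> real" where
  "normalized_volume P = fact CARD('n) * measure lebesgue P"

fun sylvester :: "nat \<Rightarrow> nat" where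
  "sylvester 0 = 2"
| "sylvester (Suc n) = 1 + (\<Prod>k\<le>n. sylvester k)"

end

(*
  The simplex P and its dual are described by vertices v_i and u_i with <u_i, v_j> = 1 for
  i \<noteq> j. If l_i are the barycentric coordinates of the origin, then
  x = \<Sum>_i l_i (1 - <u_i, x>) v_i expresses every point through its slacks with respect to
  the facets of P, and transposing the identity exchanges the roles of u and v. Hence P is cut
  out by the u_i, and its dual is the convex hull of the u_i. An integer point in the interior
  has integral <u_i, x> < 1, hence <u_i, x> \<le> 0; since \<Sum>_i l_i u_i = 0 all of these vanish.

  Both simplices have the same barycentric coordinates 1/4, 1/(4B), 1/(4 m_k), so the linear map
  U with v_i U = u_i for all i exists. It is integral because each Sylvester number b_k divides
  1 + \<Prod>_(j \<noteq> k) b_j, and its inverse, with rows v_0 and (v_0 - v_k)/2, is integral as well.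
  The normalized volume is 2^(d+1) B with B = b_0 ... b_(d-4), whereas
  b_d - 1 = b_(d-1) b_(d-2) b_(d-3) B.
*)
theory Submission
  imports Defs
begin

section \<open>Reflexivity of polar simplices\<close>

lemma integer_point_inner:
  assumes "integer_point x" "integer_point y"
  shows "x \<bullet> y \<in> \<int>"
  using assms by (auto simp: integer_point_def inner_vec_def)

lemma integral_polytope_convex_hull:
  assumes "finite S" "\<And>x. x \<in> S \<Longrightarrow> integer_point x"
  shows "integral_polytope (convex hull S)"
  using assms by (auto simp: integral_polytope_def polytope_def dest: extreme_point_of_convex_hull)

text \<open>\<open>resolution\<close> says that the maps x -> l_i <u_i, x> v_i add up to minus the
  identity. It stands in for the conditions <u_i, v_j> = 1 with i and j distinct.\<close>

locale polar_simplices =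
  fixes u v :: "'i::finite \<Rightarrow> real ^ 'n::finite" and l :: "'i \<Rightarrow> real"
  assumes weight_pos: "l i > 0"
    and weight_sum: "(\<Sum>i\<in>UNIV. l i) = 1"
    and weight_u: "(\<Sum>i\<in>UNIV. l i *\<^sub>R u i) = 0"
    and weight_v: "(\<Sum>i\<in>UNIV. l i *\<^sub>R v i) = 0"
    and resolution: "(\<Sum>i\<in>UNIV. (l i * (u i \<bullet> x)) *\<^sub>R v i) = - x"
    and inner_le_1: "u i \<bullet> v j \<le> 1"
begin

text \<open>The adjoint of minus the identity is again minus the identity, so every result below
  also holds with u and v exchanged.\<close>

lemma flip: "polar_simplices v u l"
proof
  fix y :: "real ^ 'n"
  have "(\<Sum>i\<in>UNIV. (l i * (v i \<bullet> y)) *\<^sub>R u i) \<bullet> x = (- y) \<bullet> x" for x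
  proof -
    have "(\<Sum>i\<in>UNIV. (l i * (v i \<bullet> y)) *\<^sub>R u i) \<bullet> x
        = (\<Sum>i\<in>UNIV. (l i * (u i \<bullet> x)) *\<^sub>R v i) \<bullet> y"
      by (simp add: inner_sum_left mult_ac)
    then show ?thesis
      unfolding resolution by (simp add: inner_commute)
  qed
  then show "(\<Sum>i\<in>UNIV. (l i * (v i \<bullet> y)) *\<^sub>R u i) = - y"
    using vector_eq_rdot by blast
qed (use weight_pos weight_sum weight_u weight_v inner_le_1 in \<open>auto simp: inner_commute\<close>)

text \<open>On the right-hand set the coefficients l_i (1 - <u_i, x>) are nonnegative; they sum to 1
  by \<open>weight_u\<close> and reproduce x by \<open>resolution\<close> and
  \<open>weight_v\<close>.\<close>

lemma convex_hull_eq_halfspaces: "convex hull (range v) = {x. \<forall>i. u i \<bullet> x \<le> 1}"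
proof
  have "convex {x. \<forall>i. u i \<bullet> x \<le> 1}"
  proof -
    have "{x. \<forall>i. u i \<bullet> x \<le> 1} = (\<Inter>i. {x. u i \<bullet> x \<le> 1})"
      by auto
    then show ?thesis
      by (simp add: convex_INT convex_halfspace_le)
  qed
  then show "convex hull (range v) \<subseteq> {x. \<forall>i. u i \<bullet> x \<le> 1}"
    by (intro hull_minimal) (auto simp: inner_le_1)
next
  show "{x. \<forall>i. u i \<bullet> x \<le> 1} \<subseteq> convex hull (range v)"
  proof
    fix x assume "x \<in> {x. \<forall>i. u i \<bullet> x \<le> 1}"
    then have x: "u i \<bullet> x \<le> 1" for i by auto
    have "(\<Sum>i\<in>UNIV. l i * (u i \<bullet> x)) = (\<Sum>i\<in>UNIV. l i *\<^sub>R u i) \<bullet> x"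
      by (simp add: inner_sum_left)
    then have "(\<Sum>i\<in>UNIV. l i * (u i \<bullet> x)) = 0"
      by (simp add: weight_u)
    then have "(\<Sum>i\<in>UNIV. l i * (1 - u i \<bullet> x)) = 1"
      by (simp add: right_diff_distrib sum_subtractf weight_sum)
    then have "(\<Sum>i\<in>UNIV. (l i * (1 - u i \<bullet> x)) *\<^sub>R v i) \<in> convex hull (range v)"
      using x less_imp_le[OF weight_pos] by (intro convex_sum) (auto intro: mult_nonneg_nonneg simp: hull_inc)
    also have "(\<Sum>i\<in>UNIV. (l i * (1 - u i \<bullet> x)) *\<^sub>R v i) = x"
      by (simp add: right_diff_distrib scaleR_diff_left sum_subtractf resolution weight_v)
    finally show "x \<in> convex hull (range v)" .
  qed
qed

text \<open>Membership in the dual need only be tested at the vertices, and the resulting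
  inequalities are the halfspace description of the flipped pair.\<close>

lemma dual_polytope_convex_hull: "dual_polytope (convex hull (range v)) = convex hull (range u)"
proof -
  have "dual_polytope (convex hull (range v)) = {y. \<forall>i. v i \<bullet> y \<le> 1}"
  proof
    show "dual_polytope (convex hull (range v)) \<subseteq> {y. \<forall>i. v i \<bullet> y \<le> 1}"
      by (auto simp: dual_polytope_def hull_inc)
    show "{y. \<forall>i. v i \<bullet> y \<le> 1} \<subseteq> dual_polytope (convex hull (range v))"
    proof
      fix y assume y: "y \<in> {y. \<forall>i. v i \<bullet> y \<le> 1}"
      have "convex hull (range v) \<subseteq> {x. y \<bullet> x \<le> 1}"
        using y by (intro hull_minimal convex_halfspace_le) (auto simp: inner_commute)
      then show "y \<in> dual_polytope (convex hull (range v))"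
        by (auto simp: dual_polytope_def inner_commute)
    qed
  qed
  then show ?thesis
    using polar_simplices.convex_hull_eq_halfspaces[OF flip] by simp
qed

lemma interior_convex_hull: "interior (convex hull (range v)) = {x. \<forall>i. u i \<bullet> x < 1}"
proof
  \<comment> \<open>The library rule asks for a nonzero normal; for \<open>u i = 0\<close> both sets
    are the whole space.\<close>
  have half: "interior {x. u i \<bullet> x \<le> 1} = {x. u i \<bullet> x < 1}" for i
    by (cases "u i = 0") (simp_all add: interior_halfspace_le)
  show "interior (convex hull (range v)) \<subseteq> {x. \<forall>i. u i \<bullet> x < 1}"
  proof (clarify)
    fix x i assume "x \<in> interior (convex hull (range v))"
    moreover have "convex hull (range v) \<subseteq> {x. u i \<bullet> x \<le> 1}"
      by (auto simp: convex_hull_eq_halfspaces)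
    ultimately have "x \<in> interior {x. u i \<bullet> x \<le> 1}"
      using interior_mono by blast
    then show "u i \<bullet> x < 1"
      by (simp add: half)
  qed
  have "open (\<Inter>i. {x. u i \<bullet> x < 1})"
    by (intro open_INT) (auto simp: open_halfspace_lt)
  also have "(\<Inter>i. {x. u i \<bullet> x < 1}) = {x. \<forall>i. u i \<bullet> x < 1}"
    by auto
  finally show "{x. \<forall>i. u i \<bullet> x < 1} \<subseteq> interior (convex hull (range v))"
    by (intro interior_maximal) (auto simp: convex_hull_eq_halfspaces less_imp_le)
qed

lemma aff_dim_convex_hull: "aff_dim (convex hull (range v)) = int CARD('n)"
proof -
  have "0 \<in> interior (convex hull (range v))"
    by (simp add: interior_convex_hull)
  then show ?thesis
    using aff_dim_nonempty_interior[of "convex hull (range v)"] by auto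
qed

lemma integer_interior_point:
  assumes u: "\<And>i. integer_point (u i)"
    and x: "x \<in> interior (convex hull (range v))" "integer_point x"
  shows "x = 0"
proof -
  have "u i \<bullet> x \<le> 0" for i
  proof -
    obtain k :: int where "u i \<bullet> x = of_int k"
      using integer_point_inner[OF u x(2)] by (auto elim: Ints_cases)
    then show ?thesis
      using x(1) by (auto simp: interior_convex_hull dest!: spec[of _ i])
  qed
  then have nonpos: "l i * (u i \<bullet> x) \<le> 0" for i
    using weight_pos[of i] by (simp add: mult_nonneg_nonpos)
  have "(\<Sum>i\<in>UNIV. l i * (u i \<bullet> x)) = (\<Sum>i\<in>UNIV. l i *\<^sub>R u i) \<bullet> x"
    by (simp add: inner_sum_left)
  \<comment> \<open>Signs are reversed so that a vanishing sum of nonnegative terms forces each term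
    to vanish; \<open>resolution\<close> then gives x = 0.\<close>
  then have "(\<Sum>i\<in>UNIV. - (l i * (u i \<bullet> x))) = 0"
    by (simp add: weight_u sum_negf)
  then have "l i * (u i \<bullet> x) = 0" for i
    using nonpos by (subst (asm) sum_nonneg_eq_0_iff) auto
  then have "(\<Sum>i\<in>UNIV. (l i * (u i \<bullet> x)) *\<^sub>R v i) = 0"
    by (simp only: scaleR_zero_left sum.neutral_const)
  then show ?thesis
    unfolding resolution by simp
qed

lemma reflexive_convex_hull:
  assumes "\<And>i. integer_point (u i)" "\<And>i. integer_point (v i)"
  shows "reflexive (convex hull (range v))"
proof -
  have "{x \<in> interior (convex hull (range v)). integer_point x} = {0}"
    using integer_interior_point[OF assms(1)]
    by (auto simp: interior_convex_hull integer_point_def)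
  moreover have "integral_polytope (convex hull (range u))" "integral_polytope (convex hull (range v))"
    using assms by (auto intro!: integral_polytope_convex_hull)
  ultimately show ?thesis
    by (simp add: reflexive_def dual_polytope_convex_hull aff_dim_convex_hull)
qed

end

section \<open>Integer matrices with an integer inverse\<close>

lemma det_integer:
  fixes A :: "real ^ 'n::finite ^ 'n"
  assumes "\<And>i j. A $ i $ j \<in> \<int>"
  shows "det A \<in> \<int>"
  unfolding det_def by (intro Ints_sum Ints_mult Ints_prod assms) (auto simp: Ints_of_int)

text \<open>Both determinants are integers and their product is 1, so they are units.\<close>

lemma det_integer_inverse:
  fixes A B :: "real ^ 'n::finite ^ 'n"
  assumes "\<And>i j. A $ i $ j \<in> \<int>" "\<And>i j. B $ i $ j \<in> \<int>" "A ** B = mat 1"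
  shows "det B = 1 \<or> det B = - 1"
proof -
  obtain a b :: int where ab: "det A = of_int a" "det B = of_int b"
    using det_integer[of A] det_integer[of B] assms(1,2) by (metis Ints_cases)
  have "det A * det B = 1"
    using assms(3) by (metis det_I det_mul)
  then have "b * a = 1"
    unfolding ab by (metis mult.commute of_int_1 of_int_eq_iff of_int_mult)
  then show ?thesis
    using zmult_eq_1_iff[of b a] ab by auto
qed

lemma Ints_divide: "b dvd a \<Longrightarrow> real a / real b \<in> \<int>"
  by (metis Ints_of_nat real_of_nat_div)

lemma sum_option: "(\<Sum>i\<in>UNIV. f i) = f None + (\<Sum>k\<in>UNIV. f (Some k))"
  for f :: "'k::finite option \<Rightarrow> 'b::comm_monoid_add"
  by (simp add: UNIV_option_conv sum.reindex)

section \<open>Volume of a simplex\<close>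

text \<open>Cramer's rule: the matrix is a diagonal one with column \<open>k0\<close> replaced by w,
  so its determinant is the diagonal determinant times the \<open>k0\<close> coordinate of the
  solution.\<close>

lemma det_replace_column:
  fixes c :: "'n::finite \<Rightarrow> real" and w :: "real ^ 'n"
  assumes "\<And>k. k \<noteq> k0 \<Longrightarrow> c k \<noteq> 0"
  shows "det (\<chi> i j. if j = k0 then w $ i else if i = j then c j else 0)
    = w $ k0 * (\<Prod>k\<in>-{k0}. c k)"
proof -
  \<comment> \<open>Column \<open>k0\<close> gets replaced, so its diagonal entry is free; the value
    1 makes the solution's \<open>k0\<close> coordinate equal to \<open>w $ k0\<close>.\<close>
  define A :: "real ^ 'n ^ 'n" where "A = (\<chi> i j. if i = j then if i = k0 then 1 else c i else 0)"
  define x :: "real ^ 'n" where "x = (\<chi> i. w $ i / (if i = k0 then 1 else c i))"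
  have Ax: "A *v x = w"
    using assms by (simp add: vec_eq_iff matrix_vector_mult_def A_def x_def
        if_distrib[of "\<lambda>x. x * _"] if_distrib[of "\<lambda>x. x / _"] cong: if_cong)
  have "(\<chi> i j. if j = k0 then w $ i else if i = j then c j else 0)
      = (\<chi> i j. if j = k0 then (A *v x) $ i else A $ i $ j)"
    unfolding Ax by (auto simp: vec_eq_iff A_def)
  then have "det (\<chi> i j. if j = k0 then w $ i else if i = j then c j else 0) = x $ k0 * det A"
    by (simp only: cramer_lemma)
  also have "det A = (\<Prod>k\<in>UNIV. if k = k0 then 1 else c k)"
    by (subst det_diagonal) (auto simp: A_def)
  also have "\<dots> = (\<Prod>k\<in>-{k0}. c k)"
    by (simp add: prod.remove[of UNIV k0] flip: Compl_eq_Diff_UNIV)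
  finally show ?thesis by (simp add: x_def)
qed

lemma content_simplex_wellorder:
  fixes c :: "'n::{finite,wellorder} \<Rightarrow> real" and p w :: "real ^ 'n::_"
  assumes c: "\<And>k. k \<noteq> k0 \<Longrightarrow> c k \<noteq> 0" and w: "w $ k0 \<noteq> 0"
  shows "measure lborel (convex hull (insert p (range (\<lambda>k. p + (if k = k0 then w else c k *\<^sub>R axis k 1)))))
    = \<bar>w $ k0 * (\<Prod>k\<in>-{k0}. c k)\<bar> / fact CARD('n)"
proof -
  define g where "g k = (if k = k0 then w else c k *\<^sub>R axis k 1)" for k
  have g0: "g k \<noteq> 0" for k
    using assms by (auto simp: g_def)
  have inj: "inj g"
  proof (rule injI)
    fix i j assume eq: "g i = g j"
    show "i = j"
    proof (rule ccontr)
      assume ne: "i \<noteq> j"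
      \<comment> \<open>Coordinate \<open>k0\<close> separates w from the axis vectors; coordinates
        i and j separate two axis vectors.\<close>
      from eq have "g i $ k0 = g j $ k0" "g i $ i = g j $ i" "g i $ j = g j $ j" by auto
      then show False
        using ne assms by (auto simp: g_def axis_def split: if_splits)
    qed
  qed
  let ?f = "\<lambda>k. p + g k"
  have inj': "inj ?f" using inj by (auto simp: inj_def)
  have notin: "p \<notin> range ?f" using g0 by auto
  have "measure lborel (convex hull (insert p (range ?f)))
      = \<bar>det (\<chi> i j. ?f j $ i - p $ i)\<bar> / fact CARD('n)"
  proof (rule content_simplex)
    show "card (insert p (range ?f)) = Suc CARD('n)"
      using notin inj' by (simp add: card_image)
    show "bij_betw ?f UNIV (insert p (range ?f) - {p})"
      using notin inj' by (simp add: bij_betw_def)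
  qed auto
  also have "(\<chi> i j. ?f j $ i - p $ i) = (\<chi> i j. if j = k0 then w $ i else if i = j then c j else 0)"
    by (auto simp: vec_eq_iff g_def axis_def)
  also have "det \<dots> = w $ k0 * (\<Prod>k\<in>-{k0}. c k)"
    using c by (rule det_replace_column)
  finally show ?thesis by (simp add: g_def)
qed

text \<open>The library evaluates the volume of a simplex in \<open>real ^ 'n\<close> only for well-ordered
  index types, so an arbitrary finite index type is replaced by a well-ordered copy of itself.\<close>

typedef ('n::finite) ordered = "UNIV :: 'n::finite set" by simp

lemma bij_Rep_ordered: "bij (Rep_ordered :: 'n::finite ordered \<Rightarrow> 'n)"
  by (metis (full_types) Rep_ordered_inject Abs_ordered_inverse UNIV_I bij_def injI surj_def)

instance ordered :: (finite) finite
proof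
  show "finite (UNIV :: 'a ordered set)"
    using bij_Rep_ordered by (metis bij_betw_finite finite_code)
qed

instantiation ordered :: (finite) wellorder
begin

definition less_eq_ordered :: "'a ordered \<Rightarrow> 'a ordered \<Rightarrow> bool" where
  "x \<le> y \<longleftrightarrow> to_nat (Rep_ordered x) \<le> to_nat (Rep_ordered y)"

definition less_ordered :: "'a ordered \<Rightarrow> 'a ordered \<Rightarrow> bool" where
  "x < y \<longleftrightarrow> to_nat (Rep_ordered x) < to_nat (Rep_ordered y)"

instance
proof
  fix P :: "'a ordered \<Rightarrow> bool" and a
  assume *: "\<And>x. (\<And>y. y < x \<Longrightarrow> P y) \<Longrightarrow> P x"
  show "P a"
    by (induction a rule: measure_induct_rule[of "\<lambda>x. to_nat (Rep_ordered x)"])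
      (auto intro: * simp: less_ordered_def)
qed (auto simp: less_eq_ordered_def less_ordered_def Rep_ordered_inject)

end

section \<open>Lebesgue measure under relabelling of coordinates\<close>

definition reindex :: "real ^ 'n::finite \<Rightarrow> real ^ 'n ordered" where
  "reindex x = (\<chi> i. x $ Rep_ordered i)"

lemma linear_reindex: "linear reindex"
  by (rule linearI) (auto simp: reindex_def vec_eq_iff)

lemma reindex_measurable: "reindex \<in> borel \<rightarrow>\<^sub>M borel"
  by (intro borel_measurable_continuous_onI linear_continuous_on linear_conv_bounded_linear[THEN iffD1] linear_reindex)

lemma inj_reindex: "inj reindex"
proof (rule injI)
  fix x y :: "real ^ 'n"
  assume "reindex x = reindex y"
  then have "x $ Rep_ordered i = y $ Rep_ordered i" for i
    by (simp add: reindex_def vec_eq_iff)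
  then show "x = y"
    by (metis Abs_ordered_inverse UNIV_I vec_eq_iff)
qed

lemma prod_Basis_cart: "(\<Prod>b\<in>Basis. (x \<bullet> b)) = (\<Prod>i\<in>UNIV. x $ i)" for x :: "real ^ 'n::finite"
proof -
  have "Basis = (\<lambda>i::'n. axis i (1::real)) ` UNIV"
    by (auto simp: Basis_vec_def)
  moreover have "inj (\<lambda>i::'n. axis i (1::real))"
    by (simp add: inj_def axis_eq_axis)
  ultimately have "(\<Prod>b\<in>Basis. (x \<bullet> b)) = (\<Prod>i\<in>UNIV. x \<bullet> axis i 1)"
    by (metis (no_types, lifting) prod.reindex_cong)
  then show ?thesis
    by (simp add: inner_axis)
qed

text \<open>Lebesgue measure is determined by its values on boxes, and relabelling pulls a box back
  to one with the same side lengths.\<close>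

lemma lborel_distr_reindex: "distr lborel lborel reindex = (lborel :: (real ^ 'n::finite ordered) measure)"
proof (rule lborel_eqI[symmetric])
  fix l u :: "real ^ 'n ordered"
  assume "\<And>b. b \<in> Basis \<Longrightarrow> l \<bullet> b \<le> u \<bullet> b"
  then have lu: "l $ i \<le> u $ i" for i
    by (metis axis_in_Basis_iff cart_eq_inner_axis Basis_real_def singletonI)
  \<comment> \<open>\<open>s\<close> inverts \<open>reindex\<close> and supplies the corners of the
    pulled-back box.\<close>
  define s :: "real ^ 'n ordered \<Rightarrow> real ^ 'n" where "s y = (\<chi> k. y $ Abs_ordered k)" for y
  have Rs: "Abs_ordered (Rep_ordered i) = i" "Rep_ordered (Abs_ordered k) = k" for i :: "'n ordered" and k
    by (simp_all add: Rep_ordered_inverse Abs_ordered_inverse)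
  have box: "reindex -` box l u = box (s l) (s u)"
    by (auto simp: mem_box_cart reindex_def s_def) (metis Rs)+
  have le: "s l \<bullet> b \<le> s u \<bullet> b" if "b \<in> Basis" for b
    using that lu by (auto simp: Basis_vec_def inner_axis s_def)
  have "emeasure (distr lborel lborel reindex) (box l u) = emeasure lborel (box (s l) (s u))"
    using reindex_measurable by (subst emeasure_distr) (auto simp: box)
  also have "\<dots> = (\<Prod>b\<in>Basis. (s u - s l) \<bullet> b)"
    using le by (simp add: emeasure_lborel_box)
  also have "\<dots> = (\<Prod>b\<in>Basis. (u - l) \<bullet> b)"
    unfolding prod_Basis_cart
    by (subst prod.reindex_bij_betw[OF bij_Rep_ordered, symmetric]) (simp add: s_def Rs)
  finally show "emeasure (distr lborel lborel reindex) (box l u) = (\<Prod>b\<in>Basis. (u - l) \<bullet> b)" .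
qed simp

lemma content_reindex:
  assumes "S \<in> sets borel" "reindex ` S \<in> sets borel"
  shows "measure lborel (reindex ` S) = measure lborel S"
proof -
  have "measure lborel (reindex ` S) = measure (distr lborel lborel reindex) (reindex ` S)"
    by (simp add: lborel_distr_reindex)
  also have "\<dots> = measure lborel S"
    using assms by (subst measure_distr) (simp_all add: reindex_measurable inj_vimage_image_eq[OF inj_reindex])
  finally show ?thesis .
qed

text \<open>\<open>reindex\<close> preserves volume and sends axis vectors to axis vectors, so the
  simplex keeps its shape in the well-ordered copy.\<close>

lemma content_simplex_axes:
  fixes c :: "'n::finite \<Rightarrow> real" and p w :: "real ^ 'n"
  assumes c: "\<And>k. k \<noteq> k0 \<Longrightarrow> c k \<noteq> 0" and w: "w $ k0 \<noteq> 0"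
  shows "measure lborel (convex hull (insert p (range (\<lambda>k. p + (if k = k0 then w else c k *\<^sub>R axis k 1)))))
    = \<bar>w $ k0 * (\<Prod>k\<in>-{k0}. c k)\<bar> / fact CARD('n)"
proof -
  let ?r = "Rep_ordered :: 'n ordered \<Rightarrow> 'n"
  let ?g = "\<lambda>k. p + (if k = k0 then w else c k *\<^sub>R axis k 1)"
  let ?S = "insert p (range ?g)"
  define k1 where "k1 = Abs_ordered k0"
  have r1: "?r k1 = k0" "?r i = k0 \<longleftrightarrow> i = k1" for i
    by (auto simp: k1_def Abs_ordered_inverse Rep_ordered_inverse)
  have card: "CARD('n ordered) = CARD('n)"
    using bij_Rep_ordered by (rule bij_betw_same_card)
  have axis: "reindex (axis (?r i) 1) = axis i 1" for i
    by (auto simp: reindex_def vec_eq_iff axis_def Rep_ordered_inject)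
  have "reindex (?g (?r i)) = reindex p + (if i = k1 then reindex w else c (?r i) *\<^sub>R axis i 1)" for i
    using r1 by (auto simp: linear_add[OF linear_reindex] linear_cmul[OF linear_reindex] axis)
  moreover have "range ?g = range (\<lambda>i. ?g (?r i))"
    by (simp only: image_image[symmetric, of ?g ?r] bij_is_surj[OF bij_Rep_ordered])
  ultimately have im: "reindex ` ?S = insert (reindex p)
      (range (\<lambda>i. reindex p + (if i = k1 then reindex w else c (?r i) *\<^sub>R axis i 1)))"
    by (simp only: image_insert image_image)
  have "measure lborel (convex hull ?S) = measure lborel (reindex ` (convex hull ?S))"
    using linear_reindex
    by (intro content_reindex[symmetric] borel_compact compact_continuous_image
        finite_imp_compact_convex_hull linear_continuous_on) (auto simp: linear_conv_bounded_linear)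
  also have "reindex ` (convex hull ?S) = convex hull (reindex ` ?S)"
    by (rule convex_hull_linear_image[OF linear_reindex])
  also have "measure lborel \<dots> = \<bar>reindex w $ k1 * (\<Prod>i\<in>-{k1}. c (?r i))\<bar> / fact CARD('n ordered)"
    unfolding im
  proof (rule content_simplex_wellorder)
    show "c (?r i) \<noteq> 0" if "i \<noteq> k1" for i
      using c that r1(2) by blast
    show "reindex w $ k1 \<noteq> 0"
      using w by (simp add: reindex_def r1(1))
  qed
  also have "(\<Prod>i\<in>-{k1}. c (?r i)) = (\<Prod>k\<in>-{k0}. c k)"
  proof (rule prod.reindex_bij_betw)
    show "bij_betw ?r (- {k1}) (- {k0})"
      using bij_betw_DiffI[OF bij_Rep_ordered, of "{k1}" "{k0}"] r1(1)
      by (simp add: bij_betw_def Compl_eq_Diff_UNIV)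
  qed
  finally show ?thesis
    by (simp add: reindex_def r1(1) card)
qed

section \<open>Self-dual simplices\<close>

text \<open>The coordinate \<open>k0\<close> plays the role of the first one; the vertices are
  $v_0$ (index \<open>None\<close>), $v_1 = e_1$ (index \<open>Some k0\<close>) and $e_1 + 2 m_k e_k$ (index \<open>Some k\<close>).\<close>

locale selfdual_simplex =
  fixes k0 :: "'n::finite" and m :: "'n \<Rightarrow> nat"
  assumes m_pos: "k \<noteq> k0 \<Longrightarrow> m k > 0"
    and egyptian: "(\<Sum>k\<in>-{k0}. 1 / real (m k)) = 3 - 1 / real (\<Prod>k\<in>-{k0}. m k)"
    and znam: "k \<noteq> k0 \<Longrightarrow> m k dvd 1 + (\<Prod>j\<in>-{k0, k}. m j)"
begin

definition B :: nat where "B = (\<Prod>k\<in>-{k0}. m k)"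

definition vert :: "'n option \<Rightarrow> real ^ 'n" where
  "vert i = (case i of
     None \<Rightarrow> (\<chi> j. if j = k0 then - 3 else - 2)
   | Some k \<Rightarrow> if k = k0 then axis k0 1 else axis k0 1 + (2 * real (m k)) *\<^sub>R axis k 1)"

text \<open>\<open>dvert i\<close> is the normal of the facet opposite \<open>vert i\<close>, scaled
  so that its inner product with every other vertex is 1.\<close>

definition dvert :: "'n option \<Rightarrow> real ^ 'n" where
  "dvert i = (case i of
     None \<Rightarrow> axis k0 1
   | Some k \<Rightarrow> if k = k0 then (\<chi> j. if j = k0 then 1 - 4 * real B else 2 * real B / real (m j))
       else axis k0 1 - 2 *\<^sub>R axis k 1)"

text \<open>\<open>egyptian\<close> is exactly the condition that these barycentric coordinates of
  the origin sum to 1.\<close>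

definition weight :: "'n option \<Rightarrow> real" where
  "weight i = (case i of None \<Rightarrow> 1 / 4
     | Some k \<Rightarrow> if k = k0 then 1 / (4 * real B) else 1 / (4 * real (m k)))"

text \<open>Forced by \<open>vert_U\<close>: v_1 = e_1 makes row \<open>k0\<close> equal to u_1, and
  v_i = e_1 + 2 m_i e_i makes row i equal to (u_i - u_1) / (2 m_i).\<close>

definition U :: "real ^ 'n ^ 'n" where
  "U = (\<chi> i. if i = k0 then dvert (Some k0)
     else (\<chi> j. if j = k0 then 2 * real B / real (m i)
            else - (real B / (real (m i) * real (m j))) - (if i = j then 1 / real (m i) else 0)))"

text \<open>The inverse of \<open>U\<close>, read off from e_1 = u_0 and 2 e_i = u_0 - u_i. All
  entries of v_0 - v_i are even, so halving keeps them integral.\<close>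

definition W :: "real ^ 'n ^ 'n" where
  "W = (\<chi> i. if i = k0 then vert None else (1 / 2) *\<^sub>R (vert None - vert (Some i)))"

lemma B_pos: "B > 0"
  unfolding B_def by (intro prod_pos) (auto simp: m_pos)

lemma egyptian_B: "(\<Sum>k\<in>-{k0}. 1 / real (m k)) = 3 - 1 / real B"
  using egyptian by (simp add: B_def)

lemma sum_split: "(\<Sum>k\<in>UNIV. f k) = f k0 + (\<Sum>k\<in>-{k0}. f k)" for f :: "'n \<Rightarrow> 'b::comm_monoid_add"
  by (simp add: Compl_eq_Diff_UNIV sum.remove)

lemma B_eq: "k \<noteq> k0 \<Longrightarrow> B = m k * (\<Prod>j\<in>-{k0, k}. m j)"
proof -
  assume "k \<noteq> k0"
  moreover have "- {k0} - {k} = - {k0, k}" by auto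
  ultimately show ?thesis
    unfolding B_def by (simp add: prod.remove[of _ k])
qed

lemma m_dvd_B: "k \<noteq> k0 \<Longrightarrow> m k dvd B"
  using B_eq[of k] by simp

lemma m_m_dvd_B:
  assumes "k \<noteq> k0" "j \<noteq> k0" "j \<noteq> k"
  shows "m k * m j dvd B"
proof -
  have "m j dvd (\<Prod>j\<in>-{k0, k}. m j)"
    using assms by (intro dvd_prodI) auto
  then show ?thesis
    using B_eq[OF assms(1)] by simp
qed

lemma integer_vert: "integer_point (vert i)"
  by (auto simp: integer_point_def vert_def axis_def split: option.splits)

lemma integer_dvert: "integer_point (dvert i)"
proof -
  have "2 * real B / real (m j) \<in> \<int>" if "j \<noteq> k0" for j
    using Ints_divide[OF dvd_mult[OF m_dvd_B[OF that], of 2]] by simp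
  then show ?thesis
    by (auto simp: integer_point_def dvert_def axis_def split: option.splits)
qed

lemma integer_U: "U $ i $ j \<in> \<int>"
proof -
  have 1: "dvert (Some k0) $ j \<in> \<int>"
    using integer_dvert by (auto simp: integer_point_def)
  have 2: "2 * real B / real (m i) \<in> \<int>" if "i \<noteq> k0"
    using Ints_divide[OF dvd_mult[OF m_dvd_B[OF that], of 2]] by simp
  have 3: "real B / (real (m i) * real (m j)) \<in> \<int>" if "i \<noteq> k0" "j \<noteq> k0" "i \<noteq> j"
    using Ints_divide[OF m_m_dvd_B[of i j]] that by simp
  \<comment> \<open>With B = m_i C the diagonal entry is -(1 + C) / m_i; this is where
    \<open>znam\<close> enters.\<close>
  have 4: "- (real B / (real (m i) * real (m i))) - 1 / real (m i) \<in> \<int>" if "i \<noteq> k0"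
  proof -
    let ?C = "\<Prod>j\<in>-{k0, i}. m j"
    have "- (real B / (real (m i) * real (m i))) - 1 / real (m i) = - (real (1 + ?C) / real (m i))"
      using m_pos[OF that] B_eq[OF that] by (simp add: field_simps)
    then show ?thesis
      using Ints_divide[OF znam[OF that]] by simp
  qed
  show ?thesis
    using 1 2 3 4 by (auto simp: U_def)
qed

lemma integer_W: "W $ i $ j \<in> \<int>"
  by (auto simp: W_def vert_def axis_def diff_divide_distrib)

text \<open>For v_1, ..., v_d this is the choice of \<open>U\<close>. That v_0 goes to u_0 as well
  is forced by the common weights, and is computed here from \<open>egyptian_B\<close>.\<close>

lemma vert_U: "vert i v* U = dvert i"
proof (cases i)
  case None
  have eg: "(\<Sum>k\<in>-{k0}. c / real (m k)) = c * (3 - 1 / real B)" for c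
    by (simp flip: egyptian_B add: sum_distrib_left)
  have comp0: "(vert None v* U) $ k0 = 1"
  proof -
    have "(vert None v* U) $ k0 = - 3 * (1 - 4 * real B) + (\<Sum>k\<in>-{k0}. (- 4 * real B) / real (m k))"
      unfolding vector_matrix_mult_def
      by (simp add: sum_split U_def dvert_def vert_def)
    also have "\<dots> = 1"
      unfolding eg using B_pos by (simp add: field_simps)
    finally show ?thesis .
  qed
  have comp: "(vert None v* U) $ j = 0" if "j \<noteq> k0" for j
  proof -
    have "(vert None v* U) $ j = - 6 * real B / real (m j)
        + (\<Sum>k\<in>-{k0}. (2 * real B / real (m j)) / real (m k) + (if k = j then 2 / real (m k) else 0))"
      unfolding vector_matrix_mult_def using that
      by (simp add: sum_split U_def dvert_def vert_def) (intro sum.cong, auto simp: field_simps)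
    also have "\<dots> = - 6 * real B / real (m j) + (2 * real B / real (m j)) * (3 - 1 / real B) + 2 / real (m j)"
      unfolding sum.distrib eg using that by (simp add: sum.delta)
    also have "\<dots> = 0"
      using B_pos m_pos[OF that] by (simp add: field_simps)
    finally show ?thesis .
  qed
  show ?thesis
    using comp0 comp None by (auto simp: vec_eq_iff dvert_def axis_def)
next
  case (Some k)
  have ax: "axis k 1 v* U = U $ k" for k
    by (simp add: vector_matrix_mult_def vec_eq_iff axis_def if_distrib[of "\<lambda>x. x * _"] cong: if_cong)
  show ?thesis
  proof (cases "k = k0")
    case True
    then show ?thesis
      using Some ax[of k0] by (simp add: vert_def U_def)
  next
    case False
    have "vert i v* U = U $ k0 + (2 * real (m k)) *\<^sub>R U $ k"
      using Some False
      by (simp add: vert_def vector_matrix_left_distrib ax scaleR_vector_matrix_assoc flip: ax)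
    also have "\<dots> = dvert i"
      using Some False m_pos[OF False] m_pos
      by (auto simp: vec_eq_iff U_def dvert_def axis_def field_simps)
    finally show ?thesis .
  qed
qed

text \<open>The rows of the product are the images under \<open>U\<close> of the rows of
  \<open>W\<close>, which \<open>vert_U\<close> expresses through u_0 and u_0 - u_i.\<close>

lemma W_U: "W ** U = mat 1"
proof -
  have row: "(W ** U) $ i = W $ i v* U" for i
    by (simp add: matrix_matrix_mult_def vector_matrix_mult_def vec_eq_iff mult.commute)
  have lin: "linear (\<lambda>x. x v* U)"
    by (simp add: linear_iff vector_matrix_left_distrib scaleR_vector_matrix_assoc)
  show ?thesis
  proof (subst vec_eq_iff, intro allI)
    fix i
    have "W $ i v* U = axis i 1"
    proof (cases "i = k0")
      case True
      then show ?thesis by (simp add: W_def vert_U) (simp add: dvert_def)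
    next
      case False
      have "W $ i v* U = (1 / 2) *\<^sub>R (vert None v* U - vert (Some i) v* U)"
        using False linear_cmul[OF lin] linear_diff[OF lin] by (simp add: W_def)
      then show ?thesis
        using False by (simp add: vert_U dvert_def)
    qed
    then show "(W ** U) $ i = mat 1 $ i"
      unfolding row by (auto simp: mat_def axis_def vec_eq_iff)
  qed
qed

sublocale polar_simplices dvert vert weight
proof
  have inner_dvert: "dvert (Some k) \<bullet> x = (if k = k0
      then (1 - 4 * real B) * x $ k0 + (\<Sum>j\<in>-{k0}. 2 * real B / real (m j) * x $ j)
      else x $ k0 - 2 * x $ k)" "dvert None \<bullet> x = x $ k0" for k x
    by (simp_all add: dvert_def inner_diff_left inner_axis')
      (simp add: inner_vec_def sum_split)
  fix i j :: "'n option" and x :: "real ^ 'n"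
  have eg: "(\<Sum>k\<in>-{k0}. c / real (m k)) = c * (3 - 1 / real B)" for c
    by (simp flip: egyptian_B add: sum_distrib_left)
  have eg4: "(\<Sum>k\<in>-{k0}. c / (4 * real (m k))) = c / 4 * (3 - 1 / real B)" for c
    using eg[of "c / 4"] by simp
  show "weight i > 0"
    using B_pos m_pos by (auto simp: weight_def split: option.splits)
  show "(\<Sum>i\<in>UNIV. weight i) = 1"
    using B_pos by (simp add: sum_option sum_split weight_def eg4) (simp add: field_simps)
  show "(\<Sum>i\<in>UNIV. weight i *\<^sub>R dvert i) = 0"
  proof (subst vec_eq_iff, intro allI)
    fix j
    show "(\<Sum>i\<in>UNIV. weight i *\<^sub>R dvert i) $ j = 0 $ j"
    proof (cases "j = k0")
      case True
      then show ?thesis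
        using B_pos by (simp add: sum_option sum_split weight_def dvert_def axis_def eg4) (simp add: field_simps)
    next
      case False
      then show ?thesis
        using B_pos
        by (simp add: sum_option sum_split weight_def dvert_def axis_def sum_negf
            if_distrib[of "\<lambda>x. _ * x"] cong: if_cong)
    qed
  qed
  show "(\<Sum>i\<in>UNIV. weight i *\<^sub>R vert i) = 0"
  proof (subst vec_eq_iff, intro allI)
    fix j
    show "(\<Sum>i\<in>UNIV. weight i *\<^sub>R vert i) $ j = 0 $ j"
    proof (cases "j = k0")
      case True
      then show ?thesis
        using B_pos by (simp add: sum_option sum_split weight_def vert_def axis_def eg4) (simp add: field_simps)
    next
      case False
      then show ?thesis
        using m_pos[OF False]
        by (simp add: sum_option sum_split weight_def vert_def axis_def sum.delta
            if_distrib[of "\<lambda>x. _ * x"] cong: if_cong)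
    qed
  qed
  show "(\<Sum>i\<in>UNIV. (weight i * (dvert i \<bullet> x)) *\<^sub>R vert i) = - x"
  proof (subst vec_eq_iff, intro allI)
    fix j
    show "(\<Sum>i\<in>UNIV. (weight i * (dvert i \<bullet> x)) *\<^sub>R vert i) $ j = (- x) $ j"
    proof (cases "j = k0")
      case True
      \<comment> \<open>The terms in \<open>?T\<close> cancel: u_1 contributes \<open>?T\<close> / 2
        and the u_k with k other than \<open>k0\<close> together contribute -\<open>?T\<close> /
        2.\<close>
      let ?T = "\<Sum>k\<in>-{k0}. x $ k / real (m k)"
      have 1: "(\<Sum>k\<in>-{k0}. 2 * real B / real (m k) * x $ k) = 2 * real B * ?T"
        by (simp add: sum_distrib_left)
      have "(\<Sum>k\<in>-{k0}. (x $ k0 - 2 * x $ k) / (4 * real (m k)))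
          = (\<Sum>k\<in>-{k0}. x $ k0 / (4 * real (m k)) - (1 / 2) * (x $ k / real (m k)))"
        by (intro sum.cong) (auto simp: diff_divide_distrib)
      also have "\<dots> = x $ k0 / 4 * (3 - 1 / real B) - (1 / 2) * ?T"
        by (simp add: sum_subtractf eg4 sum_distrib_left)
      finally show ?thesis
        using True B_pos 1
        by (simp add: sum_option sum_split weight_def inner_dvert vert_def axis_def) (simp add: field_simps)
    next
      case False
      then show ?thesis
        using m_pos[OF False]
        by (simp add: sum_option sum_split weight_def inner_dvert vert_def axis_def sum.delta
            if_distrib[of "\<lambda>x. _ * x"] cong: if_cong) (simp add: field_simps)
    qed
  qed
  \<comment> \<open>Distinct indices give exactly 1, equal ones 1 - 1 / \<open>weight i\<close>.
    Pairing u_1 with v_0 is the case that needs the Egyptian fraction identity.\<close>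
  show "dvert i \<bullet> vert j \<le> 1"
  proof -
    have "dvert (Some k0) \<bullet> vert None \<le> 1"
      using B_pos eg[of "- 4 * real B"] by (simp add: inner_dvert vert_def sum_negf) (simp add: field_simps)
    moreover have "dvert (Some k0) \<bullet> vert (Some k) \<le> 1" if "k \<noteq> k0" for k
      using that m_pos[OF that] B_pos
      by (simp add: inner_dvert vert_def axis_def sum.delta if_distrib[of "\<lambda>x. _ * x"] cong: if_cong)
    ultimately show ?thesis
      by (cases i; cases j) (auto simp: inner_dvert vert_def axis_def)
  qed
qed

lemma reflexive_simplex: "reflexive (convex hull (range vert))"
  by (intro reflexive_convex_hull integer_vert integer_dvert)

text \<open>\<open>U\<close> maps vertices to vertices, so no translation is required; its
  determinant is a unit because \<open>W\<close> is an integral inverse.\<close>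

lemma unimodularly_equivalent_dual:
  "unimodularly_equivalent (convex hull (range vert)) (dual_polytope (convex hull (range vert)))"
proof -
  have "linear (\<lambda>x. x v* U)"
    by (simp add: linear_iff vector_matrix_left_distrib scaleR_vector_matrix_assoc)
  then have "(\<lambda>x. x v* U) ` (convex hull (range vert)) = convex hull (range dvert)"
    by (simp add: convex_hull_linear_image image_image vert_U)
  then have "dual_polytope (convex hull (range vert)) = (\<lambda>x. x v* U + 0) ` (convex hull (range vert))"
    by (simp add: dual_polytope_convex_hull)
  moreover have "integral_polytope (convex hull (range vert))" "integral_polytope (convex hull (range dvert))"
    using integer_vert integer_dvert by (auto intro!: integral_polytope_convex_hull)
  moreover have "det U = 1 \<or> det U = - 1"
    using det_integer_inverse[OF integer_W integer_U W_U] .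
  moreover have "integer_point (0 :: real ^ 'n)"
    by (simp add: integer_point_def)
  ultimately show ?thesis
    unfolding unimodularly_equivalent_def
    using integer_U aff_dim_convex_hull polar_simplices.aff_dim_convex_hull[OF flip] dual_polytope_convex_hull
    by metis
qed

lemma normalized_volume_simplex:
  "normalized_volume (convex hull (range vert)) = 2 ^ (CARD('n) + 1) * real B"
proof -
  \<comment> \<open>Based at v_1 = e_1, all edges except the one to v_0 are parallel to coordinate
    axes.\<close>
  let ?p = "axis k0 1 :: real ^ 'n" and ?c = "\<lambda>k. 2 * real (m k)"
  let ?w = "vert None - ?p"
  let ?g = "\<lambda>k. ?p + (if k = k0 then ?w else ?c k *\<^sub>R axis k 1)"
  have "range vert = insert ?p (range ?g)"
  proof (intro equalityI subsetI)
    fix x assume "x \<in> range vert"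
    then obtain i where i: "x = vert i" by auto
    show "x \<in> insert ?p (range ?g)"
    proof (cases i)
      case None
      then have "x = ?g k0" using i by simp
      then show ?thesis by blast
    next
      case (Some k)
      show ?thesis
      proof (cases "k = k0")
        case True
        then show ?thesis using i Some by (simp add: vert_def)
      next
        case False
        then have "x = ?g k" using i Some by (simp add: vert_def)
        then show ?thesis by blast
      qed
    qed
  next
    fix x assume "x \<in> insert ?p (range ?g)"
    then consider "x = ?p" | k where "x = ?g k" by blast
    then show "x \<in> range vert"
    proof cases
      case 1
      then have "x = vert (Some k0)" by (simp add: vert_def)
      then show ?thesis by blast
    next
      case (2 k)
      then have "x = vert (if k = k0 then None else Some k)" by (simp add: vert_def)
      then show ?thesis by blast
    qed
  qed
  then have "measure lborel (convex hull (range vert)) = measure lborel (convex hull (insert ?p (range ?g)))"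
    by (simp only:)
  also have "\<dots> = \<bar>?w $ k0 * (\<Prod>k\<in>-{k0}. ?c k)\<bar> / fact CARD('n)"
    using m_pos by (intro content_simplex_axes) (auto simp: vert_def)
  also have "?w $ k0 = - 4"
    by (simp add: vert_def)
  also have "(\<Prod>k\<in>-{k0}. ?c k) = 2 ^ (CARD('n) - 1) * real B"
    by (simp add: prod.distrib B_def Compl_eq_Diff_UNIV)
  also have "\<bar>- 4 * (2 ^ (CARD('n) - 1) * real B)\<bar> = 2 ^ (CARD('n) + 1) * real B"
    by (cases "CARD('n)") (auto simp: abs_mult)
  finally have "measure lborel (convex hull (range vert)) = 2 ^ (CARD('n) + 1) * real B / fact CARD('n)" .
  moreover have "convex hull (range vert) \<in> sets borel"
    by (intro borel_compact finite_imp_compact_convex_hull) simp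
  ultimately show ?thesis
    by (simp add: normalized_volume_def measure_completion)
qed

end

section \<open>The Sylvester sequence\<close>

lemma sylvester_Suc: "sylvester (Suc n) = 1 + (\<Prod>k<Suc n. sylvester k)"
  by (simp only: sylvester.simps lessThan_Suc_atMost)

text \<open>At n = 0 the empty product yields b_0 = 2, so one formula covers both defining
  clauses.\<close>

lemma sylvester_eq: "sylvester n = 1 + (\<Prod>k<n. sylvester k)"
  by (cases n) (simp_all only: sylvester_Suc sylvester.simps(1), simp)

lemma sylvester_pos: "sylvester n > 0"
  by (subst sylvester_eq) simp

lemma sylvester_Suc_eq: "sylvester (Suc n) - 1 = sylvester n * (sylvester n - 1)"
proof -
  have "(\<Prod>k<n. sylvester k) = sylvester n - 1"
    using sylvester_eq[of n] by simp
  then show ?thesis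
    by (simp add: sylvester_Suc del: sylvester.simps)
qed

lemma sylvester_ge_2: "sylvester n \<ge> 2"
proof -
  have "(\<Prod>k<n. sylvester k) > 0"
    by (intro prod_pos) (auto simp: sylvester_pos)
  then show ?thesis
    using sylvester_eq[of n] by linarith
qed

text \<open>The sum telescopes: with p = b_0 ... b_(n-1) and b_n = 1 + p, partial fractions give 1 /
  b_n = 1 / p - 1 / (p b_n).\<close>

lemma sum_inverse_sylvester:
  "(\<Sum>k<n. 1 / real (sylvester k)) = 1 - 1 / real (\<Prod>k<n. sylvester k)"
proof (induction n)
  case (Suc n)
  define p where "p = (\<Prod>k<n. sylvester k)"
  have b: "sylvester n = 1 + p"
    unfolding p_def by (rule sylvester_eq)
  have "real p > 0"
    unfolding p_def using sylvester_pos by (auto intro!: prod_pos simp del: of_nat_prod)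
  then have "1 / ((1 + real p) * real p) = 1 / real p - 1 / (1 + real p)"
    by (simp add: divide_simps)
  then have "1 / real (sylvester n * p) = 1 / real p - 1 / real (sylvester n)"
    by (simp only: b of_nat_mult of_nat_add of_nat_1)
  then show ?case
    using Suc by (simp add: mult.commute del: of_nat_prod of_nat_mult flip: p_def)
qed simp

text \<open>For i = n the right side is b_n itself. Otherwise b_n = 1 + b_i X, so 1 + b_n X = (1 +
  X) + b_i X^2 and the induction hypothesis covers 1 + X.\<close>

lemma sylvester_dvd_Suc_prod:
  "i < n \<Longrightarrow> sylvester i dvd 1 + (\<Prod>k\<in>{..<n} - {i}. sylvester k)"
proof (induction n)
  case (Suc n)
  show ?case
  proof (cases "i = n")
    case True
    have "{..<Suc n} - {n} = {..<n}" by auto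
    then show ?thesis
      using True sylvester_eq[of n] by simp
  next
    case False
    let ?X = "\<Prod>k\<in>{..<n} - {i}. sylvester k"
    have i: "i < n" using Suc.prems False by simp
    have "{..<Suc n} - {i} = insert n ({..<n} - {i})" using i by auto
    then have "(\<Prod>k\<in>{..<Suc n} - {i}. sylvester k) = sylvester n * ?X" by simp
    also have "sylvester n = 1 + sylvester i * ?X"
      using sylvester_eq[of n] i by (simp add: prod.remove[of "{..<n}" i])
    finally have "1 + (\<Prod>k\<in>{..<Suc n} - {i}. sylvester k) = (1 + ?X) + sylvester i * (?X * ?X)"
      by (simp add: algebra_simps)
    then show ?thesis
      using Suc.IH[OF i] by (metis dvd_add dvd_triv_left)
  qed
qed simp

lemma sylvester_double: "2 * sylvester n \<le> sylvester (Suc n) + 1"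
proof -
  have "2 * (sylvester n - 1) \<le> sylvester n * (sylvester n - 1)"
    using sylvester_ge_2[of n] by simp
  then show ?thesis
    using sylvester_Suc_eq[of n] sylvester_pos[of "Suc n"] sylvester_pos[of n] by linarith
qed

text \<open>By \<open>sylvester_double\<close>, b_n - 1 at least doubles at each step, starting from
  1.\<close>

lemma sylvester_ge_power: "sylvester n \<ge> 2 ^ n + 1"
proof (induction n)
  case (Suc n)
  then show ?case
    using sylvester_double[of n] by simp
qed simp

text \<open>The volume bound for n = d - 3. The right side is b_(n+2) b_(n+1) b_n times the same
  product, so it remains to compare the power of 2 with three Sylvester numbers.\<close>

lemma power_less_sylvester:
  "2 ^ (n + 4) * (\<Prod>k<n. sylvester k) < sylvester (n + 3) - 1"
proof -
  let ?p = "\<Prod>k<n. sylvester k"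
  have p: "?p = sylvester n - 1" "?p > 0"
    using sylvester_eq[of n] sylvester_pos by (auto intro!: prod_pos)
  have "2 ^ (n + 4) < sylvester (n + 2) * (sylvester (n + 1) * sylvester n)"
  proof -
    have "2 * 2 ^ n + 1 \<le> sylvester (n + 1)" "4 * 2 ^ n + 1 \<le> sylvester (n + 2)"
      using sylvester_ge_power[of "n + 1"] sylvester_ge_power[of "n + 2"]
      by (simp_all del: sylvester.simps)
    moreover have "1 \<le> (2::nat) ^ n" by simp
    ultimately have "2 * 2 ^ n + 1 \<le> sylvester (n + 1)" "5 \<le> sylvester (n + 2)"
      by linarith+
    \<comment> \<open>The lower bounds 5, 2^(n+1) + 1 and 2 multiply to more than 20 * 2^n, which
      exceeds 16 * 2^n.\<close>
    then have "5 * ((2 * 2 ^ n + 1) * 2) \<le> sylvester (n + 2) * (sylvester (n + 1) * sylvester n)"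
      using sylvester_ge_2[of n] by (intro mult_mono) auto
    then show ?thesis by (simp only: power_add) simp
  qed
  then have "2 ^ (n + 4) * ?p < sylvester (n + 2) * (sylvester (n + 1) * sylvester n) * ?p"
    using p(2) by simp
  also have "\<dots> = sylvester (n + 2) * (sylvester (n + 1) * (sylvester n * (sylvester n - 1)))"
    unfolding p(1) by (simp only: mult.assoc)
  also have "\<dots> = sylvester (Suc (n + 2)) - 1"
    using sylvester_Suc_eq[of n] sylvester_Suc_eq[of "n + 1"] sylvester_Suc_eq[of "n + 2"]
    by (simp only: Suc_eq_plus1 add.assoc one_add_one)
  also have "Suc (n + 2) = n + 3" by simp
  finally show ?thesis .
qed

section \<open>The multipliers of the given vertices\<close>

lemma atLeastAtMost_2_eq: "d \<ge> 3 \<Longrightarrow> {2..d::nat} = insert 2 (insert 3 ((\<lambda>i. i + 4) ` {..<d - 3}))"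
proof (intro equalityI subsetI)
  fix i assume "d \<ge> 3" "i \<in> {2..d}"
  then have "i = 2 \<or> i = 3 \<or> (i = (i - 4) + 4 \<and> i - 4 < d - 3)"
    by auto
  then show "i \<in> insert 2 (insert 3 ((\<lambda>i. i + 4) ` {..<d - 3}))"
    by blast
qed auto

text \<open>The vertices are $v_i = e_1 + 2 m_i e_i$ with $m_2 = m_3 = 1$ and $m_i = b_{i-4}$ for $i \<ge> 4$.\<close>

definition scale :: "nat \<Rightarrow> nat" where
  "scale i = (if i < 4 then 1 else sylvester (i - 4))"

lemma prod_scale: "d \<ge> 3 \<Longrightarrow> (\<Prod>i=2..d. scale i) = (\<Prod>k<d - 3. sylvester k)"
  by (subst atLeastAtMost_2_eq) (auto simp: scale_def prod.reindex image_iff)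

text \<open>The indices 2 and 3 contribute 1 each, which raises the 1 in the Sylvester identity to
  3.\<close>

lemma sum_scale:
  "d \<ge> 3 \<Longrightarrow> (\<Sum>i=2..d. 1 / real (scale i)) = 3 - 1 / real (\<Prod>i=2..d. scale i)"
  using sum_inverse_sylvester[of "d - 3"]
  by (simp only: prod_scale, subst atLeastAtMost_2_eq) (auto simp: scale_def sum.reindex image_iff)

text \<open>The multipliers equal to 1 drop out of the product, leaving the divisibility for
  Sylvester numbers shifted by 4.\<close>

lemma scale_dvd:
  assumes "d \<ge> 3" "i \<in> {2..d}"
  shows "scale i dvd 1 + (\<Prod>j\<in>{2..d} - {i}. scale j)"
proof (cases "i < 4")
  case False
  then have "{2..d} - {i} = insert 2 (insert 3 ((\<lambda>i. i + 4) ` ({..<d - 3} - {i - 4})))"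
    using assms by (subst atLeastAtMost_2_eq) auto
  then have "(\<Prod>j\<in>{2..d} - {i}. scale j) = (\<Prod>k\<in>{..<d - 3} - {i - 4}. sylvester k)"
    by (simp add: scale_def prod.reindex image_iff)
  then show ?thesis
    using sylvester_dvd_Suc_prod[of "i - 4" "d - 3"] False assms by (simp add: scale_def)
qed (simp add: scale_def)

section \<open>Transport along the enumeration of coordinates\<close>

theorem theorem2p2:
  fixes d :: nat
    and coord :: "nat \<Rightarrow> 'n::finite"
    and e v :: "nat \<Rightarrow> real ^ 'n"
    and P :: "(real ^ 'n) set"
  assumes "d = CARD('n)" and "d \<ge> 3"
    and "bij_betw coord {1..d} UNIV"
    and "\<And>i. i \<in> {1..d} \<Longrightarrow> e i = axis (coord i) 1"
    and "v 0 = (- 3) *\<^sub>R e 1 - 2 *\<^sub>R (\<Sum>j=2..d. e j)"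
    and "v 1 = e 1"
    and "\<And>i. i \<in> {2, 3} \<Longrightarrow> v i = e 1 + 2 *\<^sub>R e i"
    and "\<And>i. i \<in> {4..d} \<Longrightarrow> v i = e 1 + (2 * real (sylvester (i - 4))) *\<^sub>R e i"
    and "P = convex hull (v ` {0..d})"
  shows "reflexive P \<and> unimodularly_equivalent P (dual_polytope P) \<and>
         normalized_volume P < real (sylvester d) - 1"
proof -
  define k0 where "k0 = coord 1"
  define m where "m = scale \<circ> inv_into {1..d} coord"
  have inj: "inj_on coord {1..d}" and surj: "coord ` {1..d} = UNIV"
    using assms(3) by (auto simp: bij_betw_def)
  have m: "m (coord i) = scale i" if "i \<in> {1..d}" for i
    using inv_into_f_f[OF inj that] by (simp add: m_def)
  \<comment> \<open>Applied with A = {1} for the sum and product over the multipliers, and with A =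
    {1, i} for the divisibility condition.\<close>
  have bij: "bij_betw coord ({1..d} - A) (- coord ` A)" if "A \<subseteq> {1..d}" for A
    unfolding bij_betw_def
    using inj_on_image_set_diff[OF inj _ that, of "{1..d}"] inj surj
    by (auto simp: inj_on_diff Compl_eq_Diff_UNIV)
  have 1: "{1..d} - {1} = {2..d}"
    by auto
  have bij1: "bij_betw coord {2..d} (- {k0})"
    using bij[of "{1}"] assms(2) 1 by (simp add: k0_def)
  have prod_m: "(\<Prod>k\<in>-{k0}. m k) = (\<Prod>i=2..d. scale i)"
    using prod.reindex_bij_betw[OF bij1, of m] m by simp
  interpret S: selfdual_simplex k0 m
  proof
    show "m k > 0" for k
      by (simp add: m_def scale_def sylvester_pos)
    have "(\<Sum>k\<in>-{k0}. 1 / real (m k)) = (\<Sum>i=2..d. 1 / real (scale i))"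
      using sum.reindex_bij_betw[OF bij1, of "\<lambda>k. 1 / real (m k)"] m by simp
    then show "(\<Sum>k\<in>-{k0}. 1 / real (m k)) = 3 - 1 / real (\<Prod>k\<in>-{k0}. m k)"
      using sum_scale[OF assms(2)] by (simp only: prod_m)
    fix k assume "k \<noteq> k0"
    then obtain i where i: "i \<in> {2..d}" "k = coord i"
      using bij_betw_imp_surj_on[OF bij1] by (metis ComplI imageE singletonD)
    have "{1..d} - {1, i} = {2..d} - {i}"
      by auto
    then have "bij_betw coord ({2..d} - {i}) (- {k0, k})"
      using bij[of "{1, i}"] i assms(2) by (simp add: k0_def)
    then have "(\<Prod>j\<in>-{k0, k}. m j) = (\<Prod>j\<in>{2..d} - {i}. scale j)"
      using prod.reindex_bij_betw[of coord "{2..d} - {i}" "- {k0, k}" m] m by simp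
    then show "m k dvd 1 + (\<Prod>j\<in>-{k0, k}. m j)"
      using scale_dvd[OF assms(2) i(1)] i m[of i] by simp
  qed
  have e1: "e 1 = axis k0 1"
    using assms(2,4) by (simp add: k0_def)
  have "(\<Sum>j=2..d. e j) = (\<Sum>j=2..d. axis (coord j) 1)"
    using assms(4) by (intro sum.cong) auto
  also have "\<dots> = (\<Sum>k\<in>-{k0}. axis k 1)"
    by (rule sum.reindex_bij_betw[OF bij1])
  finally have v0: "v 0 = S.vert None"
    using assms(5) unfolding e1 by (auto simp: S.vert_def vec_eq_iff axis_def)
  have v: "v i = S.vert (Some (coord i))" if i: "i \<in> {1..d}" for i
  proof (cases "i = 1")
    case True
    then show ?thesis
      unfolding True assms(6) e1 k0_def[symmetric] by (simp add: S.vert_def)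
  next
    case False
    have "coord i \<noteq> k0"
      using False i assms(2) inj_onD[OF inj, of i 1] by (auto simp: k0_def)
    moreover have "v i = e 1 + (2 * real (scale i)) *\<^sub>R e i"
    proof (cases "i < 4")
      case True
      then have "i \<in> {2, 3}" using False i by auto
      then show ?thesis using assms(7)[of i] by (auto simp: scale_def)
    next
      case False
      then show ?thesis using assms(8)[of i] i by (simp add: scale_def)
    qed
    ultimately show ?thesis
      using i assms(4) unfolding e1 by (simp add: S.vert_def m)
  qed
  have "{0..d} = insert 0 {1..d}"
    by auto
  then have "v ` {0..d} = insert (v 0) (v ` {1..d})"
    by simp
  also have "v ` {1..d} = (S.vert \<circ> Some) ` coord ` {1..d}"
    using v by (auto simp: image_iff)
  also have "insert (v 0) \<dots> = range S.vert"
    unfolding surj v0 by (simp add: UNIV_option_conv image_comp)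
  finally have P: "P = convex hull (range S.vert)"
    using assms(9) by simp
  \<comment> \<open>For n = d - 3 the exponent n + 4 is d + 1 and the index n + 3 is d.\<close>
  have "2 ^ (d + 1) * S.B < sylvester d - 1"
    using power_less_sylvester[of "d - 3"] assms(2) by (simp add: S.B_def prod_m prod_scale)
  then have "real (2 ^ (d + 1) * S.B) < real (sylvester d - 1)"
    by (simp only: of_nat_less_iff)
  \<comment> \<open>Positivity of b_d makes the truncated subtraction of naturals agree with the
    real one.\<close>
  then have "normalized_volume P < real (sylvester d) - 1"
    using sylvester_pos[of d] assms(1) by (simp add: P S.normalized_volume_simplex of_nat_diff)
  then show ?thesis
    unfolding P using S.reflexive_simplex S.unimodularly_equivalent_dual by blast
qed

end
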